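(* For every real $\beta\ge 3$ we have $\ell_\beta=1$, where $$\ell_\beta:=\inf\left\{\left|\sum_{i=0}^{n-1}d_i\beta^i\right|\ne 0:\ d_i\in\{0,\pm1,\pm\beta,\pm(\beta+1)\},\ n\in\mathbb{N}\right\}.$$
   Context: The infimum is over all nonzero values of $\left|\sum_{i=0}^{n-1}d_i\beta^i\right|$, with $n\ge1$ and each digit $d_i\in\Omega-\Omega=\{0,\pm 1,\pm \beta,\pm (\beta+1)\}$, where $\Omega=\{0,1,\beta+1\}$. *)

theory Defs
  imports Complex_Main
begin

definition digits :: "real \<Rightarrow> real set" where
  "digits \<beta> = {0, 1, -1, \<beta>, -\<beta>, \<beta> + 1, -(\<beta> + 1)}"

text \<open>The set below contains 1 (take \<open>n = 1\<close> and the digit 1) and is bounded below by 0, so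
  \<open>Inf\<close> on the reals is the genuine infimum. Only the digits with index below \<open>n\<close> are
  constrained; the others do not occur in the sum.\<close>

definition ell :: "real \<Rightarrow> real" where
  "ell \<beta> = Inf {\<bar>\<Sum>i<n. d i * \<beta> ^ i\<bar> | (n::nat) (d::nat \<Rightarrow> real).
      n \<ge> 1 \<and> (\<forall>i<n. d i \<in> digits \<beta>) \<and> \<bar>\<Sum>i<n. d i * \<beta> ^ i\<bar> \<noteq> 0}"

end

theory Submission
  imports Defs
begin

text \<open>
  Every digit has the form \<open>a + b * \<beta>\<close> with integers \<open>a\<close>, \<open>b\<close> of absolute value at most 1, so
  shifting the parts \<open>b * \<beta>\<close> to the next power turns the sums in question into values
  at \<open>\<beta>\<close> of integer polynomials with coefficients in \<open>{-2, ..., 2}\<close>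
  (lemma \<open>sum_carry\<close>). If \<open>\<beta> \<ge> 3\<close>, the leading term of such a polynomial exceeds the sum of all
  lower terms in absolute value by at least 1, because
  \<open>2 * (1 + \<beta> + ... + \<beta>^(n-1)) \<le> \<beta>^n - 1\<close>. Hence a nonzero value has absolute value at least 1
  (lemma \<open>int_poly_value_gap\<close>), and the digit 1 alone attains this bound.
\<close>

lemma int_poly_value_bound:
  fixes \<beta> :: real and c :: "nat \<Rightarrow> int"
  assumes "\<beta> \<ge> 3" and "\<And>i. \<bar>c i\<bar> \<le> 2"
  shows "\<bar>\<Sum>i<n. of_int (c i) * \<beta> ^ i\<bar> \<le> \<beta> ^ n - 1"
proof (induction n)
  case 0
  then show ?case by simp
next
  case (Suc n)
  have "\<bar>of_int (c n) * \<beta> ^ n\<bar> \<le> 2 * \<beta> ^ n"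
    using assms(1) assms(2)[of n] by (simp add: abs_mult mult_right_mono)
  moreover have "3 * \<beta> ^ n \<le> \<beta> ^ Suc n"
    using assms(1) by simp
  ultimately show ?case
    using Suc.IH by simp
qed

text \<open>Integrality makes a nonzero leading coefficient at least 1 in absolute value, so the bound
  \<open>\<beta> ^ n - 1\<close> on the lower terms leaves a remainder of at least 1.\<close>

lemma int_poly_value_gap:
  fixes \<beta> :: real and c :: "nat \<Rightarrow> int"
  assumes "\<beta> \<ge> 3" and "\<And>i. \<bar>c i\<bar> \<le> 2"
    and "(\<Sum>i<n. of_int (c i) * \<beta> ^ i) \<noteq> 0"
  shows "1 \<le> \<bar>\<Sum>i<n. of_int (c i) * \<beta> ^ i\<bar>"
  using assms(3)
proof (induction n)
  case 0
  then show ?case by simp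
next
  case (Suc n)
  show ?case
  proof (cases "c n = 0")
    case True
    then show ?thesis using Suc by simp
  next
    case False
    then have "1 \<le> \<bar>c n\<bar>" by linarith
    then have "1 \<le> \<bar>real_of_int (c n)\<bar>" by linarith
    then have "\<beta> ^ n \<le> \<bar>of_int (c n) * \<beta> ^ n\<bar>"
      using assms(1) by (simp add: abs_mult)
    moreover have "\<bar>\<Sum>i<n. of_int (c i) * \<beta> ^ i\<bar> \<le> \<beta> ^ n - 1"
      using int_poly_value_bound assms(1,2) by blast
    ultimately show ?thesis by simp
  qed
qed

lemma digit_decomposition:
  assumes "x \<in> digits \<beta>"
  shows "\<exists>a b :: int. \<bar>a\<bar> \<le> 1 \<and> \<bar>b\<bar> \<le> 1 \<and> x = of_int a + of_int b * \<beta>"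
proof -
  have "\<exists>a\<in>{-1, 0, 1::int}. \<exists>b\<in>{-1, 0, 1::int}. x = of_int a + of_int b * \<beta>"
    using assms by (auto simp: digits_def)
  then obtain a b :: int where "a \<in> {-1, 0, 1}" "b \<in> {-1, 0, 1}" "x = of_int a + of_int b * \<beta>"
    by blast
  moreover from this have "\<bar>a\<bar> \<le> 1" "\<bar>b\<bar> \<le> 1" by auto
  ultimately show ?thesis by blast
qed

text \<open>The summand \<open>a n * \<beta> ^ n\<close> on the left gives the last coefficient on the right the same shape
  as the others; it vanishes when \<open>a\<close> is extended by 0.\<close>

lemma sum_carry:
  fixes \<beta> :: "'a :: comm_ring_1" and a b :: "nat \<Rightarrow> int"
  shows "(\<Sum>i<n. (of_int (a i) + of_int (b i) * \<beta>) * \<beta> ^ i) + of_int (a n) * \<beta> ^ n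
    = (\<Sum>i<Suc n. of_int (a i + (case i of 0 \<Rightarrow> 0 | Suc j \<Rightarrow> b j)) * \<beta> ^ i)"
  by (induction n) (simp_all add: algebra_simps)

lemma digit_sum_gap:
  fixes \<beta> :: real
  assumes "\<beta> \<ge> 3" and digs: "\<forall>i<n. d i \<in> digits \<beta>"
    and nz: "(\<Sum>i<n. d i * \<beta> ^ i) \<noteq> 0"
  shows "1 \<le> \<bar>\<Sum>i<n. d i * \<beta> ^ i\<bar>"
proof -
  have "\<forall>i. \<exists>a b :: int. \<bar>a\<bar> \<le> 1 \<and> \<bar>b\<bar> \<le> 1
      \<and> (if i < n then d i = of_int a + of_int b * \<beta> else a = 0)"
  proof
    fix i
    show "\<exists>a b :: int. \<bar>a\<bar> \<le> 1 \<and> \<bar>b\<bar> \<le> 1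
      \<and> (if i < n then d i = of_int a + of_int b * \<beta> else a = 0)"
    proof (cases "i < n")
      case True
      then show ?thesis using digs digit_decomposition[of "d i" \<beta>] by simp
    next
      case False
      then show ?thesis by (simp add: exI[of _ "0::int"])
    qed
  qed
  then obtain a b :: "nat \<Rightarrow> int" where a: "\<And>i. \<bar>a i\<bar> \<le> 1" and b: "\<And>i. \<bar>b i\<bar> \<le> 1"
    and ab: "\<And>i. if i < n then d i = of_int (a i) + of_int (b i) * \<beta> else a i = 0"
    unfolding choice_iff by blast
  define c where "c i = a i + (case i of 0 \<Rightarrow> 0 | Suc j \<Rightarrow> b j)" for i
  have c: "\<bar>c i\<bar> \<le> 2" for i
  proof (cases i)
    case 0
    then show ?thesis using a[of 0] by (simp add: c_def)
  next
    case (Suc j)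
    then show ?thesis using a[of i] b[of j] by (simp add: c_def)
  qed
  have "(\<Sum>i<n. d i * \<beta> ^ i) = (\<Sum>i<n. (of_int (a i) + of_int (b i) * \<beta>) * \<beta> ^ i)"
  proof (intro sum.cong refl)
    fix i assume "i \<in> {..<n}"
    then show "d i * \<beta> ^ i = (of_int (a i) + of_int (b i) * \<beta>) * \<beta> ^ i"
      using ab[of i] by simp
  qed
  also have "\<dots> = (\<Sum>i<Suc n. of_int (c i) * \<beta> ^ i)"
    using sum_carry[of a b \<beta> n] ab[of n] unfolding c_def by simp
  finally show ?thesis
    using int_poly_value_gap[where c = c and n = "Suc n", OF assms(1) c] nz by simp
qed

theorem proposition1p2:
  fixes \<beta> :: real
  assumes "\<beta> \<ge> 3"
  shows "ell \<beta> = 1"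
  unfolding ell_def
proof (rule cInf_eq_minimum)
  show "1 \<in> {\<bar>\<Sum>i<n. d i * \<beta> ^ i\<bar> | (n::nat) (d::nat \<Rightarrow> real).
      n \<ge> 1 \<and> (\<forall>i<n. d i \<in> digits \<beta>) \<and> \<bar>\<Sum>i<n. d i * \<beta> ^ i\<bar> \<noteq> 0}"
    by (rule CollectI, rule exI[of _ 1], rule exI[of _ "\<lambda>_. 1"]) (simp add: digits_def)
qed (use digit_sum_gap[OF assms] in auto)

end
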